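(* Let $N=pq$ with $p,q$ primes such that $\nu_2(p-1)\neq\nu_2(q-1)$. Let $a\in\mathbb{Z}$ with $\gcd(a,N)=1$ and $\left(\frac{a}{N}\right)_2=1$, and let $v:=\nu_2(N-1)$. Then $a\in\mathbb{Z}_{N,2}^*$ if and only if $\left(\frac{a^{2^v}}{N}\right)_{2^{v+1}}=1$.
   Context: $\nu_2(n):=\max\{k\in\mathbb{N}_0:2^k\mid n\}$. For $k\in\mathbb{N}_0$, a prime $p$ and $a\in\mathbb{Z}$ with $p\nmid a$, $\left(\frac{a}{p}\right)_{2^k}=1$ if there is $x\in\mathbb{Z}$ with $x^{2^k}\equiv a \pmod p$, and $-1$ otherwise; for $n=p_1\cdots p_l$ (primes not necessarily distinct) with $\gcd(n,a)=1$, $\left(\frac{a}{n}\right)_{2^k}:=\prod_i\left(\frac{a}{p_i}\right)_{2^k}$. $\mathbb{Z}_{N,2}^*$ denotes the set of units modulo $N$ that are squares modulo $N$ (quadratic residues modulo $N$). *)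

theory Defs
  imports "HOL-Number_Theory.Number_Theory"
begin

definition residue_symbol_prime :: "nat \<Rightarrow> int \<Rightarrow> nat \<Rightarrow> int" where
  "residue_symbol_prime k a p = (if \<exists>x::int. [x ^ (2 ^ k) = a] (mod int p) then 1 else -1)"

text \<open>Only meaningful for \<open>n > 0\<close> and \<open>a\<close> coprime to \<open>n\<close>.\<close>

definition residue_symbol :: "nat \<Rightarrow> int \<Rightarrow> nat \<Rightarrow> int" where
  "residue_symbol k a n = (\<Prod>p\<in>#prime_factorization n. residue_symbol_prime k a p)"

text \<open>Residue classes modulo \<open>N\<close> are represented by their least non-negative elements.\<close>

definition quadratic_residues :: "nat \<Rightarrow> int set" where
  "quadratic_residues N = {x \<in> {0..<int N}. coprime x (int N) \<and> QuadRes (int N) x}"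

end

theory Submission
  imports Defs
begin

text \<open>
  Let \<open>s < t\<close> be the 2-adic valuations of \<open>p - 1\<close> and \<open>q - 1\<close>. Since
  \<open>p q - 1 = (p - 1) q + (q - 1)\<close> and \<open>q\<close> is odd, \<open>v = s\<close>. Modulo \<open>p\<close>, squaring is a
  permutation of the \<open>2\<^sup>s\<close>-th powers, so the symbol of \<open>a ^ 2\<^sup>s\<close> at \<open>p\<close> is always 1. Modulo \<open>q\<close>,
  raising \<open>x ^ 2\<^sup>s\<^sup>+\<^sup>1 = a ^ 2\<^sup>s\<close> to the power \<open>(q - 1) / 2\<^sup>s\<^sup>+\<^sup>1\<close> gives
  \<open>a ^ ((q - 1) / 2) = 1\<close>, so the symbol at \<open>q\<close> is the quadratic one. As the quadratic symbols at
  \<open>p\<close> and \<open>q\<close> agree, the one at \<open>q\<close> decides whether \<open>a\<close> is a square modulo \<open>p q\<close>.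
\<close>

lemma residue_symbol_prime_mult:
  assumes "prime p" "prime q"
  shows "residue_symbol k a (p * q) = residue_symbol_prime k a p * residue_symbol_prime k a q"
  using assms
  by (simp add: residue_symbol_def prime_factorization_mult prime_factorization_prime)

lemma residue_symbol_prime_cases:
  "residue_symbol_prime k a p = 1 \<or> residue_symbol_prime k a p = -1"
  by (simp add: residue_symbol_prime_def)

lemma residue_symbol_prime_eq_1_iff:
  "residue_symbol_prime k a p = 1 \<longleftrightarrow> (\<exists>x. [x ^ (2 ^ k) = a] (mod int p))"
  by (simp add: residue_symbol_prime_def)

lemma residue_symbol_prime_1_eq_1_iff:
  "residue_symbol_prime 1 a p = 1 \<longleftrightarrow> QuadRes (int p) a"
  by (simp add: residue_symbol_prime_def QuadRes_def)

lemma fermat_theorem_int: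
  fixes a :: int
  assumes "prime p" "coprime a (int p)"
  shows "[a ^ (p - 1) = 1] (mod int p)"
proof -
  obtain b :: nat where b: "[a = int b] (mod int p)"
    using assms(1) by (metis cong_mod_right cong_refl mod_int_pos_iff nat_0_le of_nat_0_less_iff
        of_nat_0_le_iff pos_mod_sign prime_gt_0_nat)
  then have "coprime (int b) (int p)"
    using assms(2) by (metis cong_imp_coprime)
  then have "\<not> p dvd b"
    using assms(1) by (metis coprime_int_iff coprime_common_divisor_nat dvd_refl not_prime_1 nat_dvd_1_iff_1)
  then have "[b ^ (p - 1) = 1] (mod p)"
    using assms(1) fermat_theorem by blast
  then have "[int b ^ (p - 1) = 1] (mod int p)"
    by (metis cong_int_iff of_nat_1 of_nat_power)
  with b show ?thesis
    by (meson cong_pow cong_trans)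
qed

text \<open>The nonzero \<open>2 ^ s\<close>-th powers modulo \<open>p\<close> form a group of odd
  order \<open>m = (p - 1) / 2 ^ s\<close>, where square roots are obtained by raising to the power
  \<open>(m + 1) / 2\<close>. The case \<open>p = 2\<close>, with \<open>s = 0\<close>, is
  included.\<close>

lemma residue_symbol_prime_power_valuation:
  assumes p: "prime p" and a: "coprime a (int p)" and s: "s = multiplicity 2 (p - 1)"
  shows "residue_symbol_prime (s + 1) (a ^ (2 ^ s)) p = 1"
proof -
  have "p - 1 \<noteq> 0" using prime_gt_1_nat[OF p] by simp
  then obtain m where m: "p - 1 = 2 ^ s * m" "\<not> 2 dvd m"
    using multiplicity_decompose'[of "p - 1" "2::nat"] s by (metis not_prime_unit two_is_prime_nat)
  \<comment> \<open>With \<open>n = (m + 1) / 2\<close>, the witness is \<open>a ^ n\<close>: its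
    exponent \<open>n * 2 ^ (s + 1)\<close> exceeds \<open>2 ^ s\<close> by exactly
    \<open>p - 1\<close>, which Fermat removes.\<close>
  then obtain n where n: "m + 1 = 2 * n" by (metis dvdE even_plus_one_iff)
  have "2 ^ (s + 1) * n = 2 ^ s * (2 * n)" by simp
  also have "\<dots> = (p - 1) + 2 ^ s"
    by (simp only: n [symmetric] m(1) distrib_left mult_1_right)
  finally have e: "n * 2 ^ (s + 1) = (p - 1) + 2 ^ s" by (simp add: mult.commute)
  have "(a ^ n) ^ (2 ^ (s + 1)) = a ^ (p - 1) * a ^ (2 ^ s)"
    unfolding power_mult [symmetric] e by (rule power_add)
  moreover have "[a ^ (p - 1) * a ^ (2 ^ s) = 1 * a ^ (2 ^ s)] (mod int p)"
    by (intro cong_mult fermat_theorem_int p a cong_refl)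
  ultimately show ?thesis
    unfolding residue_symbol_prime_eq_1_iff by (metis mult_1)
qed

lemma residue_symbol_prime_power_below_valuation:
  assumes q: "prime q" and a: "coprime a (int q)" and s: "s < multiplicity 2 (q - 1)"
  shows "residue_symbol_prime (s + 1) (a ^ (2 ^ s)) q = 1 \<longleftrightarrow> residue_symbol_prime 1 a q = 1"
proof
  have "2 ^ (s + 1) dvd q - 1"
    using s by (intro multiplicity_dvd') simp
  then obtain m where m: "q - 1 = 2 ^ (s + 1) * m" ..
  have q1: "q > 1" using prime_gt_1_nat[OF q] .
  \<comment> \<open>For \<open>q = 2\<close> the even number \<open>2 ^ (s + 1) * m\<close> would
    equal 1. Euler's criterion needs an odd prime.\<close>
  have q2: "q > 2"
    using q1 m by (cases "q = 2") auto
  have half: "(q - 1) div 2 = 2 ^ s * m" unfolding m by simp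
  assume "residue_symbol_prime (s + 1) (a ^ (2 ^ s)) q = 1"
  then obtain x where x: "[x ^ (2 ^ (s + 1)) = a ^ (2 ^ s)] (mod int q)"
    unfolding residue_symbol_prime_eq_1_iff by blast
  have "coprime (x ^ (2 ^ (s + 1))) (int q)"
    using x a by (metis cong_imp_coprime cong_sym coprime_power_left_iff)
  then have "coprime x (int q)" by simp
  then have "[1 = x ^ (q - 1)] (mod int q)"
    using fermat_theorem_int q cong_sym by blast
  also have "[x ^ (q - 1) = a ^ ((q - 1) div 2)] (mod int q)"
    unfolding half unfolding m power_mult using x by (rule cong_pow)
  also have "[a ^ ((q - 1) div 2) = Legendre a (int q)] (mod int q)"
    using euler_criterion[OF q q2] cong_sym by blast
  finally have "[Legendre a (int q) = 1] (mod int q)" by (rule cong_sym)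
  \<comment> \<open>The Legendre symbol is -1, 0 or 1, and modulo \<open>q > 2\<close> only the
    value 1 is congruent to 1.\<close>
  moreover have "\<not> [-1 = 1] (mod int q)" "\<not> [0 = 1] (mod int q)"
    using q2 by (auto simp: cong_iff_dvd_diff dest: zdvd_imp_le)
  ultimately have "QuadRes (int q) a"
    by (auto simp: Legendre_def split: if_splits)
  then show "residue_symbol_prime 1 a q = 1"
    unfolding residue_symbol_prime_1_eq_1_iff .
next
  assume "residue_symbol_prime 1 a q = 1"
  then obtain y where "[y ^ 2 = a] (mod int q)"
    by (auto simp: residue_symbol_prime_eq_1_iff)
  \<comment> \<open>Both sides of \<open>y ^ 2 = a\<close> are raised to the power
    \<open>2 ^ s\<close>.\<close>
  then have "[y ^ (2 ^ (s + 1)) = a ^ (2 ^ s)] (mod int q)"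
    by (metis Suc_eq_plus1 cong_pow power_Suc power_mult)
  then show "residue_symbol_prime (s + 1) (a ^ (2 ^ s)) q = 1"
    unfolding residue_symbol_prime_eq_1_iff by blast
qed

text \<open>The Chinese remainder theorem glues a root modulo \<open>m\<close> and a root modulo
  \<open>n\<close> into a common one.\<close>

lemma QuadRes_mult_coprime_iff:
  fixes m n a :: int
  assumes "coprime m n"
  shows "QuadRes (m * n) a \<longleftrightarrow> QuadRes m a \<and> QuadRes n a"
proof
  assume "QuadRes (m * n) a"
  then show "QuadRes m a \<and> QuadRes n a"
    unfolding QuadRes_def by (metis cong_modulus_mult mult.commute)
next
  assume "QuadRes m a \<and> QuadRes n a"
  then obtain x y where xy: "[x\<^sup>2 = a] (mod m)" "[y\<^sup>2 = a] (mod n)"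
    by (auto simp: QuadRes_def)
  obtain z where z: "[z = x] (mod m)" "[z = y] (mod n)"
    using binary_chinese_remainder_int[OF assms] by blast
  have "[z\<^sup>2 = a] (mod m)" "[z\<^sup>2 = a] (mod n)"
    using z xy by (meson cong_pow cong_trans)+
  then show "QuadRes (m * n) a"
    unfolding QuadRes_def using assms coprime_cong_mult by blast
qed

lemma mod_in_quadratic_residues_iff:
  assumes "N > 0" "coprime a (int N)"
  shows "a mod int N \<in> quadratic_residues N \<longleftrightarrow> QuadRes (int N) a"
  using assms by (simp add: quadratic_residues_def QuadRes_def cong_def)

lemma multiplicity_2_mult_minus_1:
  fixes p q :: nat
  assumes "p > 1" "q > 1" and less: "multiplicity 2 (p - 1) < multiplicity 2 (q - 1)"
  shows "multiplicity 2 (p * q - 1) = multiplicity 2 (p - 1)"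
proof -
  \<comment> \<open>The valuation of \<open>q - 1\<close> exceeds another natural number, so it is
    positive.\<close>
  have "even (q - 1)"
    using less by (metis less_nat_zero_code not_dvd_imp_multiplicity_0)
  then have q: "odd q" using assms(2) by simp
  then have m: "multiplicity 2 ((p - 1) * q) = multiplicity 2 (p - 1)"
    using assms(1,2) by (simp add: prime_elem_multiplicity_mult_distrib not_dvd_imp_multiplicity_0)
  have "p * q - 1 = (p - 1) * q + (q - 1)"
    using assms(1,2) by (simp add: diff_mult_distrib)
  \<comment> \<open>The two summands have different valuations, so the sum takes the smaller
    one.\<close>
  moreover have "multiplicity 2 ((p - 1) * q + (q - 1)) = multiplicity 2 ((p - 1) * q)"
    using assms m by (intro multiplicity_sum_lt) auto
  ultimately show ?thesis using m by simp
qed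

text \<open>The ordered case, to which the theorem reduces because \<open>p\<close> and
  \<open>q\<close> enter it symmetrically.\<close>

lemma quadratic_residue_iff_of_valuation_less:
  fixes p q :: nat and a :: int
  assumes p: "prime p" and q: "prime q"
    and less: "multiplicity 2 (p - 1) < multiplicity 2 (q - 1)"
    and a: "coprime a (int (p * q))"
    and sym: "residue_symbol 1 a (p * q) = 1"
    and v: "v = multiplicity 2 (p * q - 1)"
  shows "a mod int (p * q) \<in> quadratic_residues (p * q) \<longleftrightarrow>
    residue_symbol (v + 1) (a ^ (2 ^ v)) (p * q) = 1"
proof -
  have vs: "v = multiplicity 2 (p - 1)"
    using v multiplicity_2_mult_minus_1[OF prime_gt_1_nat[OF p] prime_gt_1_nat[OF q] less] by simp
  have ap: "coprime a (int p)" and aq: "coprime a (int q)" using a by auto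
  have "p \<noteq> q" using less by auto
  then have "coprime (int p) (int q)"
    using p q by (simp add: primes_coprime)
  then have "a mod int (p * q) \<in> quadratic_residues (p * q) \<longleftrightarrow>
      residue_symbol_prime 1 a p = 1 \<and> residue_symbol_prime 1 a q = 1"
    using a p q mod_in_quadratic_residues_iff[of "p * q" a] prime_gt_0_nat
    unfolding residue_symbol_prime_1_eq_1_iff
    by (simp add: QuadRes_mult_coprime_iff)
  \<comment> \<open>Two signs with product 1 are equal, so the condition at \<open>p\<close> follows
    from the one at \<open>q\<close>.\<close>
  also have "\<dots> \<longleftrightarrow> residue_symbol_prime 1 a q = 1"
    using sym residue_symbol_prime_cases[of 1 a p]
    unfolding residue_symbol_prime_mult[OF p q] by auto
  also have "\<dots> \<longleftrightarrow> residue_symbol (v + 1) (a ^ (2 ^ v)) (p * q) = 1"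
    using residue_symbol_prime_power_valuation[OF p ap vs]
      residue_symbol_prime_power_below_valuation[OF q aq, of v] less vs
    unfolding residue_symbol_prime_mult[OF p q] by simp
  finally show ?thesis .
qed

theorem theorem10:
  fixes p q N v :: nat and a :: int
  assumes "prime p" and "prime q"
    and "N = p * q"
    and "multiplicity 2 (p - 1) \<noteq> multiplicity 2 (q - 1)"
    and "coprime a (int N)"
    and "residue_symbol 1 a N = 1"
    and "v = multiplicity 2 (N - 1)"
  shows "a mod int N \<in> quadratic_residues N \<longleftrightarrow> residue_symbol (v + 1) (a ^ (2 ^ v)) N = 1"
proof (cases "multiplicity 2 (p - 1) < multiplicity 2 (q - 1)")
  case True
  then show ?thesis
    using quadratic_residue_iff_of_valuation_less[of p q a v] assms by simp
next
  case False
  then have "multiplicity 2 (q - 1) < multiplicity 2 (p - 1)" using assms(4) by simp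
  moreover have "N = q * p" using assms(3) by simp
  ultimately show ?thesis
    using quadratic_residue_iff_of_valuation_less[of q p a v] assms(1,2,5-7) by metis
qed

end
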